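(* Let $\Delta,\Gamma$ be finite simplicial complexes. If $\phi:\Delta\to\Gamma$ is a strongly connected simplicial map, then for any $q\in\mathcal{P}(\Gamma)$ which spans an extreme ray of $\mathcal{P}(\Gamma)$, $\phi^*(q)$ spans an extreme ray of $\mathcal{P}(\Delta)$.
   Context: A simplicial complex $\Delta$ on a finite vertex set $V(\Delta)$ is a family of subsets of $V(\Delta)$ (called faces) that is closed under taking subsets and contains all singletons; its edges are its two-element faces. A simplicial map $\phi:\Delta\to\Gamma$ is a map $V(\Delta)\to V(\Gamma)$ taking faces to faces; it is surjective if every face of $\Gamma$ is the image $\phi(T)$ of some face $T\in\Delta$. Let $I(\Delta)\subseteq\mathbb{R}[x_i:i\in V(\Delta)]$ be the ideal generated by the monomials $\prod_{i\in S}x_i$ with $S\subseteq V(\Delta)$, $S\notin\Delta$, and let $R_2(\Delta)$ be the degree 2 homogeneous part of $\mathbb{R}[x_i:i\in V(\Delta)]/I(\Delta)$. Elements of $R_2(\Delta)$ are regarded as functions on $\mathcal{V}(\Delta)=\bigcup_{F\in\Delta}\operatorname{span}\{e_i:i\in F\}\subseteq\mathbb{R}^{V(\Delta)}$. Let $\mathcal{P}(\Delta)\subseteq R_2(\Delta)$ be the convex cone of quadratic forms that are nonnegative on $\mathcal{V}(\Delta)$. For a simplicial map $\phi:\Delta\to\Gamma$, $\phi^*:\mathcal{P}(\Gamma)\to\mathcal{P}(\Delta)$ is the pullback along the linear map $\mathcal{V}(\Delta)\to\mathcal{V}(\Gamma)$ induced by $e_i\mapsto e_{\phi(i)}$. A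 nonzero element $x$ of a convex cone $C$ spans an extreme ray if there are no linearly independent $y,z\in C$ with $x=y+z$. A surjective simplicial map $\phi:\Delta\to\Gamma$ is strongly connected if: (1) whenever $a,b\in V(\Delta)$ and $\phi(a)=\phi(b)=c\in V(\Gamma)$, there is a sequence $a=x_1,x_2,\dots,x_k=b$ in $V(\Delta)$ with $\phi(x_i)=c$ for all $i$ and $\{x_i,x_{i+1}\}\in\Delta$ for each $1\le i\le k-1$; (2) whenever $a,b$ are edges of $\Delta$ and $\phi(a)=\phi(b)=c$ is an edge of $\Gamma$, there is a sequence of edges $a=e_1,e_2,\dots,e_k=b$ of $\Delta$ with $\phi(e_i)=c$ for all $i$, and $e_i\cup e_{i+1}\in\Delta$ and $e_i\cap e_{i+1}\ne\varnothing$ for each $1\le i\le k-1$. *)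

theory Defs
  imports Complex_Main "HOL-Algebra.QuotRing" "HOL-Algebra.Module" "HOL-Library.Poly_Mapping"
begin

definition simplicial_complex :: "'a set \<Rightarrow> 'a set set \<Rightarrow> bool" where
  "simplicial_complex V \<Delta> \<longleftrightarrow>
     finite V \<and> \<Delta> \<subseteq> Pow V \<and> (\<forall>F\<in>\<Delta>. \<forall>G. G \<subseteq> F \<longrightarrow> G \<in> \<Delta>) \<and> (\<forall>v\<in>V. {v} \<in> \<Delta>)"

definition edges :: "'a set set \<Rightarrow> 'a set set" where
  "edges \<Delta> = {F \<in> \<Delta>. card F = 2}"

definition simplicial_map ::
  "'a set \<Rightarrow> 'a set set \<Rightarrow> 'b set \<Rightarrow> 'b set set \<Rightarrow> ('a \<Rightarrow> 'b) \<Rightarrow> bool" where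
  "simplicial_map V \<Delta> W \<Gamma> \<phi> \<longleftrightarrow> \<phi> ` V \<subseteq> W \<and> (\<forall>F\<in>\<Delta>. \<phi> ` F \<in> \<Gamma>)"

definition surjective_simplicial_map ::
  "'a set \<Rightarrow> 'a set set \<Rightarrow> 'b set \<Rightarrow> 'b set set \<Rightarrow> ('a \<Rightarrow> 'b) \<Rightarrow> bool" where
  "surjective_simplicial_map V \<Delta> W \<Gamma> \<phi> \<longleftrightarrow>
     simplicial_map V \<Delta> W \<Gamma> \<phi> \<and> (\<forall>F\<in>\<Gamma>. \<exists>T\<in>\<Delta>. \<phi> ` T = F)"

definition strongly_connected ::
  "'a set \<Rightarrow> 'a set set \<Rightarrow> 'b set \<Rightarrow> 'b set set \<Rightarrow> ('a \<Rightarrow> 'b) \<Rightarrow> bool" where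
  "strongly_connected V \<Delta> W \<Gamma> \<phi> \<longleftrightarrow>
     surjective_simplicial_map V \<Delta> W \<Gamma> \<phi> \<and>
     (\<forall>a\<in>V. \<forall>b\<in>V. \<forall>c\<in>W. \<phi> a = c \<and> \<phi> b = c \<longrightarrow>
        (\<exists>xs. xs \<noteq> [] \<and> hd xs = a \<and> last xs = b \<and> set xs \<subseteq> V \<and> (\<forall>x\<in>set xs. \<phi> x = c) \<and>
              successively (\<lambda>x y. {x, y} \<in> \<Delta>) xs)) \<and>
     (\<forall>a\<in>edges \<Delta>. \<forall>b\<in>edges \<Delta>. \<forall>c\<in>edges \<Gamma>. \<phi> ` a = c \<and> \<phi> ` b = c \<longrightarrow>
        (\<exists>es. es \<noteq> [] \<and> hd es = a \<and> last es = b \<and> set es \<subseteq> edges \<Delta> \<and>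
              (\<forall>e\<in>set es. \<phi> ` e = c) \<and>
              successively (\<lambda>e f. e \<union> f \<in> \<Delta> \<and> e \<inter> f \<noteq> {}) es))"

text \<open>A monomial is a finitely supported exponent vector and a polynomial is a finitely
  supported family of coefficients, so that \<open>(*)\<close> on this type is polynomial multiplication.\<close>

type_synonym 'a rpoly = "('a \<Rightarrow>\<^sub>0 nat) \<Rightarrow>\<^sub>0 real"

definition Var :: "'a \<Rightarrow> 'a rpoly" where
  "Var i = Poly_Mapping.single (Poly_Mapping.single i 1) 1"

definition Const :: "real \<Rightarrow> 'a rpoly" where
  "Const c = Poly_Mapping.single 0 c"

definition polynomial_ring :: "'a set \<Rightarrow> 'a rpoly ring" where
  "polynomial_ring V =
     \<lparr>carrier = {p. \<forall>m\<in>Poly_Mapping.keys p. Poly_Mapping.keys m \<subseteq> V},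
      mult = (*), one = 1, zero = 0, add = (+)\<rparr>"

definition homogeneous :: "nat \<Rightarrow> 'a rpoly \<Rightarrow> bool" where
  "homogeneous d p \<longleftrightarrow>
     (\<forall>m\<in>Poly_Mapping.keys p. (\<Sum>i\<in>Poly_Mapping.keys m. Poly_Mapping.lookup m i) = d)"

definition poly_eval :: "'a rpoly \<Rightarrow> ('a \<Rightarrow> real) \<Rightarrow> real" where
  "poly_eval p v = (\<Sum>m\<in>Poly_Mapping.keys p. Poly_Mapping.lookup p m *
     (\<Prod>i\<in>Poly_Mapping.keys m. v i ^ Poly_Mapping.lookup m i))"

definition SR_ideal :: "'a set \<Rightarrow> 'a set set \<Rightarrow> 'a rpoly set" where
  "SR_ideal V \<Delta> = genideal (polynomial_ring V) {\<Prod>i\<in>S. Var i | S. S \<subseteq> V \<and> S \<notin> \<Delta>}"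

definition SR_class :: "'a set \<Rightarrow> 'a set set \<Rightarrow> 'a rpoly \<Rightarrow> 'a rpoly set" where
  "SR_class V \<Delta> p = SR_ideal V \<Delta> +>\<^bsub>polynomial_ring V\<^esub> p"

text \<open>The quotient ring as a real algebra: the ring structure is that of the factor ring, and a
  scalar acts as multiplication by the class of the constant polynomial.\<close>

definition SR_algebra :: "'a set \<Rightarrow> 'a set set \<Rightarrow> (real, 'a rpoly set) module" where
  "SR_algebra V \<Delta> =
     (let Q = polynomial_ring V Quot SR_ideal V \<Delta> in
      \<lparr>carrier = carrier Q, mult = mult Q, one = one Q, zero = zero Q, add = add Q,
       smult = (\<lambda>c X. mult Q (SR_class V \<Delta> (Const c)) X)\<rparr>)"

definition R2 :: "'a set \<Rightarrow> 'a set set \<Rightarrow> 'a rpoly set set" where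
  "R2 V \<Delta> = SR_class V \<Delta> ` {p \<in> carrier (polynomial_ring V). homogeneous 2 p}"

definition unit_vec :: "'a \<Rightarrow> 'a \<Rightarrow> real" where
  "unit_vec i = (\<lambda>j. if j = i then 1 else 0)"

text \<open>The union of the coordinate subspaces spanned by the faces; vectors of the real vector
  space on \<open>V\<close> are functions vanishing outside \<open>V\<close>.\<close>

definition face_vectors :: "'a set set \<Rightarrow> ('a \<Rightarrow> real) set" where
  "face_vectors \<Delta> = (\<Union>F\<in>\<Delta>. {(\<lambda>j. \<Sum>i\<in>F. c i * unit_vec i j) | c. True})"

text \<open>Polynomials in the ideal vanish on \<open>face_vectors \<Delta>\<close>, so all representatives of a class
  take the same value there; elsewhere \<open>SR_eval\<close> is not meaningful.\<close>

definition SR_eval :: "'a rpoly set \<Rightarrow> ('a \<Rightarrow> real) \<Rightarrow> real" where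
  "SR_eval X v = the_elem ((\<lambda>p. poly_eval p v) ` X)"

definition nonneg_cone :: "'a set \<Rightarrow> 'a set set \<Rightarrow> 'a rpoly set set" where
  "nonneg_cone V \<Delta> = {X \<in> R2 V \<Delta>. \<forall>v\<in>face_vectors \<Delta>. SR_eval X v \<ge> 0}"

definition induced_linear :: "'a set \<Rightarrow> ('a \<Rightarrow> 'b) \<Rightarrow> ('a \<Rightarrow> real) \<Rightarrow> 'b \<Rightarrow> real" where
  "induced_linear V \<phi> v = (\<lambda>j. \<Sum>i\<in>V. v i * unit_vec (\<phi> i) j)"

text \<open>An element of \<open>R2 V \<Delta>\<close> is determined by its values on \<open>face_vectors \<Delta>\<close>, so the pullback is
  the element that, as a function, is the composition with the linear map
  induced by \<open>\<phi>\<close>.\<close>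

definition pullback ::
  "'a set \<Rightarrow> 'a set set \<Rightarrow> ('a \<Rightarrow> 'b) \<Rightarrow> 'b rpoly set \<Rightarrow> 'a rpoly set" where
  "pullback V \<Delta> \<phi> q =
     (THE X. X \<in> R2 V \<Delta> \<and>
        (\<forall>v\<in>face_vectors \<Delta>. SR_eval X v = SR_eval q (induced_linear V \<phi> v)))"

definition lin_indep_pair :: "(real, 'm, 'c) module_scheme \<Rightarrow> 'm \<Rightarrow> 'm \<Rightarrow> bool" where
  "lin_indep_pair M y z \<longleftrightarrow>
     (\<forall>a b. (a \<odot>\<^bsub>M\<^esub> y) \<oplus>\<^bsub>M\<^esub> (b \<odot>\<^bsub>M\<^esub> z) = \<zero>\<^bsub>M\<^esub> \<longrightarrow> a = 0 \<and> b = 0)"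

definition spans_extreme_ray :: "(real, 'm, 'c) module_scheme \<Rightarrow> 'm set \<Rightarrow> 'm \<Rightarrow> bool" where
  "spans_extreme_ray M C x \<longleftrightarrow>
     x \<in> C \<and> x \<noteq> \<zero>\<^bsub>M\<^esub> \<and>
     \<not> (\<exists>y\<in>C. \<exists>z\<in>C. lin_indep_pair M y z \<and> x = y \<oplus>\<^bsub>M\<^esub> z)"

end

theory Submission
  imports Defs
begin

text \<open>If \<open>\<phi>\<^sup>*q = y + z\<close> with \<open>y\<close> and \<open>z\<close> nonnegative, then \<open>y\<close> vanishes on \<open>e\<^sub>a - e\<^sub>b\<close> for every edge
  \<open>{a, b}\<close> collapsed by \<open>\<phi>\<close>. Nonnegativity on a face \<open>{a, b, c}\<close> then forces the coefficients of
  \<open>y\<close> at \<open>{a, c}\<close> and \<open>{b, c}\<close> to agree. Along the paths provided by strong connectivity,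
  the coefficients of \<open>y\<close> depend only on the images under \<open>\<phi>\<close>, so \<open>y\<close> is a pullback. So is \<open>z\<close>,
  and linear independence of the pair descends to \<open>\<Gamma>\<close>, against the extremality of \<open>q\<close>.\<close>

section \<open>Evaluation of polynomials\<close>

lemma poly_mapping_sum_singles:
  "p = (\<Sum>m\<in>Poly_Mapping.keys p. Poly_Mapping.single m (Poly_Mapping.lookup p m))"
proof (rule poly_mapping_eqI)
  fix k
  show "Poly_Mapping.lookup p k =
    Poly_Mapping.lookup (\<Sum>m\<in>Poly_Mapping.keys p. Poly_Mapping.single m (Poly_Mapping.lookup p m)) k"
    by (simp add: lookup_sum lookup_single when_def in_keys_iff)
qed

definition monomial_eval :: "('a \<Rightarrow>\<^sub>0 nat) \<Rightarrow> ('a \<Rightarrow> real) \<Rightarrow> real" where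
  "monomial_eval m v = (\<Prod>i\<in>Poly_Mapping.keys m. v i ^ Poly_Mapping.lookup m i)"

lemma monomial_eval_superset:
  assumes "finite A" "Poly_Mapping.keys m \<subseteq> A"
  shows "monomial_eval m v = (\<Prod>i\<in>A. v i ^ Poly_Mapping.lookup m i)"
  unfolding monomial_eval_def
  by (rule prod.mono_neutral_left) (use assms in \<open>auto simp: in_keys_iff\<close>)

lemma monomial_eval_add: "monomial_eval (m + n) v = monomial_eval m v * monomial_eval n v"
proof -
  let ?A = "Poly_Mapping.keys m \<union> Poly_Mapping.keys n"
  have "monomial_eval (m + n) v = (\<Prod>i\<in>?A. v i ^ Poly_Mapping.lookup (m + n) i)"
    by (rule monomial_eval_superset) (simp_all add: keys_add)
  moreover have "monomial_eval m v = (\<Prod>i\<in>?A. v i ^ Poly_Mapping.lookup m i)"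
    "monomial_eval n v = (\<Prod>i\<in>?A. v i ^ Poly_Mapping.lookup n i)"
    by (auto intro!: monomial_eval_superset)
  ultimately show ?thesis
    by (simp add: lookup_add power_add prod.distrib)
qed

lemma monomial_eval_zero [simp]: "monomial_eval 0 v = 1"
  by (simp add: monomial_eval_def)

lemma monomial_eval_single [simp]: "monomial_eval (Poly_Mapping.single i k) v = v i ^ k"
  by (cases "k = 0") (auto simp: monomial_eval_def)

lemma poly_eval_superset:
  assumes "finite A" "Poly_Mapping.keys p \<subseteq> A"
  shows "poly_eval p v = (\<Sum>m\<in>A. Poly_Mapping.lookup p m * monomial_eval m v)"
  unfolding poly_eval_def monomial_eval_def
  by (rule sum.mono_neutral_left) (use assms in \<open>auto simp: in_keys_iff\<close>)

lemma poly_eval_add: "poly_eval (p + q) v = poly_eval p v + poly_eval q v"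
proof -
  let ?A = "Poly_Mapping.keys p \<union> Poly_Mapping.keys q"
  have "poly_eval (p + q) v = (\<Sum>m\<in>?A. Poly_Mapping.lookup (p + q) m * monomial_eval m v)"
    by (rule poly_eval_superset) (simp_all add: keys_add)
  moreover have "poly_eval p v = (\<Sum>m\<in>?A. Poly_Mapping.lookup p m * monomial_eval m v)"
    "poly_eval q v = (\<Sum>m\<in>?A. Poly_Mapping.lookup q m * monomial_eval m v)"
    by (auto intro!: poly_eval_superset)
  ultimately show ?thesis
    by (simp add: lookup_add algebra_simps sum.distrib)
qed

lemma poly_eval_zero [simp]: "poly_eval 0 v = 0"
  by (simp add: poly_eval_def)

lemma poly_eval_single [simp]: "poly_eval (Poly_Mapping.single m c) v = c * monomial_eval m v"
  by (cases "c = 0") (auto simp: poly_eval_def monomial_eval_def)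

lemma poly_eval_one [simp]: "poly_eval 1 v = 1"
  by (simp flip: single_one)

lemma poly_eval_sum: "poly_eval (\<Sum>i\<in>A. f i) v = (\<Sum>i\<in>A. poly_eval (f i) v)"
  by (induction A rule: infinite_finite_induct) (auto simp: poly_eval_add)

lemma poly_eval_uminus: "poly_eval (- p) v = - poly_eval p v"
  using poly_eval_add[of p "- p" v] by simp

lemma poly_eval_mult: "poly_eval (p * q) v = poly_eval p v * poly_eval q v"
proof -
  have "poly_eval (Poly_Mapping.single m c * q) v = c * monomial_eval m v * poly_eval q v" for m c
  proof -
    have "Poly_Mapping.single m c * q =
      (\<Sum>n\<in>Poly_Mapping.keys q. Poly_Mapping.single (m + n) (c * Poly_Mapping.lookup q n))"
      by (subst poly_mapping_sum_singles[of q]) (simp add: sum_distrib_left mult_single)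
    then have "poly_eval (Poly_Mapping.single m c * q) v =
      (\<Sum>n\<in>Poly_Mapping.keys q. c * monomial_eval m v * (Poly_Mapping.lookup q n * monomial_eval n v))"
      by (simp add: poly_eval_sum monomial_eval_add mult_ac)
    also have "\<dots> = c * monomial_eval m v * poly_eval q v"
      unfolding sum_distrib_left[symmetric] by (simp add: poly_eval_def monomial_eval_def)
    finally show ?thesis .
  qed
  moreover have "poly_eval (p * q) v =
    (\<Sum>m\<in>Poly_Mapping.keys p. poly_eval (Poly_Mapping.single m (Poly_Mapping.lookup p m) * q) v)"
    by (subst poly_mapping_sum_singles[of p]) (simp only: sum_distrib_right poly_eval_sum)
  ultimately have "poly_eval (p * q) v =
    (\<Sum>m\<in>Poly_Mapping.keys p. Poly_Mapping.lookup p m * monomial_eval m v) * poly_eval q v"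
    by (simp add: sum_distrib_right)
  then show ?thesis
    by (simp add: poly_eval_def[of p] monomial_eval_def)
qed

lemma poly_eval_prod: "poly_eval (\<Prod>i\<in>A. f i) v = (\<Prod>i\<in>A. poly_eval (f i) v)"
  by (induction A rule: infinite_finite_induct) (auto simp: poly_eval_mult)

lemma poly_eval_Var [simp]: "poly_eval (Var i) v = v i"
  by (simp add: Var_def)

section \<open>The Stanley-Reisner ring\<close>

lemma polynomial_ring_simps [simp]:
  "mult (polynomial_ring V) = (*)" "one (polynomial_ring V) = 1"
  "zero (polynomial_ring V) = 0" "add (polynomial_ring V) = (+)"
  by (simp_all add: polynomial_ring_def)

lemma carrier_polynomial_ring:
  "p \<in> carrier (polynomial_ring V) \<longleftrightarrow>
    (\<forall>m\<in>Poly_Mapping.keys p. Poly_Mapping.keys m \<subseteq> V)"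
  by (simp add: polynomial_ring_def)

lemma polynomial_ring_add_closed:
  assumes "p \<in> carrier (polynomial_ring V)" "q \<in> carrier (polynomial_ring V)"
  shows "p + q \<in> carrier (polynomial_ring V)"
  using assms keys_add[of p q] unfolding carrier_polynomial_ring by blast

lemma polynomial_ring_mult_closed:
  assumes "p \<in> carrier (polynomial_ring V)" "q \<in> carrier (polynomial_ring V)"
  shows "p * q \<in> carrier (polynomial_ring V)"
  unfolding carrier_polynomial_ring
proof
  fix m assume "m \<in> Poly_Mapping.keys (p * q)"
  then obtain a b where "m = a + b" "a \<in> Poly_Mapping.keys p" "b \<in> Poly_Mapping.keys q"
    using keys_mult[of p q] by blast
  then show "Poly_Mapping.keys m \<subseteq> V"
    using assms keys_add[of a b] unfolding carrier_polynomial_ring by blast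
qed

lemma cring_polynomial_ring: "cring (polynomial_ring V)"
proof (rule cringI)
  show "abelian_group (polynomial_ring V)"
  proof (rule abelian_groupI)
    fix p assume p: "p \<in> carrier (polynomial_ring V)"
    show "\<exists>q\<in>carrier (polynomial_ring V). q \<oplus>\<^bsub>polynomial_ring V\<^esub> p = \<zero>\<^bsub>polynomial_ring V\<^esub>"
      by (rule bexI[of _ "- p"]) (use p in \<open>auto simp: carrier_polynomial_ring in_keys_iff\<close>)
  qed (auto simp: polynomial_ring_add_closed algebra_simps, auto simp: carrier_polynomial_ring)
  show "comm_monoid (polynomial_ring V)"
    by (rule comm_monoidI)
       (auto simp: polynomial_ring_mult_closed algebra_simps, auto simp: carrier_polynomial_ring)
qed (simp add: algebra_simps)

lemma a_minus_polynomial_ring: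
  assumes "p \<in> carrier (polynomial_ring V)" "q \<in> carrier (polynomial_ring V)"
  shows "p \<ominus>\<^bsub>polynomial_ring V\<^esub> q = p - q"
proof -
  interpret cring "polynomial_ring V" by (rule cring_polynomial_ring)
  have "(p \<ominus>\<^bsub>polynomial_ring V\<^esub> q) + q = p"
    using assms a_assoc[of p "\<ominus>\<^bsub>polynomial_ring V\<^esub> q" q] l_neg[of q]
    by (simp add: a_minus_def)
  then show ?thesis by (simp add: algebra_simps)
qed

lemma Const_in_carrier: "Const c \<in> carrier (polynomial_ring V)"
  by (auto simp: carrier_polynomial_ring Const_def)

lemma Var_in_carrier: "i \<in> V \<Longrightarrow> Var i \<in> carrier (polynomial_ring V)"
  by (auto simp: carrier_polynomial_ring Var_def)

lemma prod_in_carrier: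
  assumes "\<And>i. i \<in> A \<Longrightarrow> f i \<in> carrier (polynomial_ring V)"
  shows "(\<Prod>i\<in>A. f i) \<in> carrier (polynomial_ring V)"
proof -
  have "1 \<in> carrier (polynomial_ring V)" by (simp add: carrier_polynomial_ring)
  then show ?thesis
    using assms
    by (induction A rule: infinite_finite_induct) (auto simp: polynomial_ring_mult_closed)
qed

lemma sum_in_carrier:
  assumes "\<And>i. i \<in> A \<Longrightarrow> f i \<in> carrier (polynomial_ring V)"
  shows "(\<Sum>i\<in>A. f i) \<in> carrier (polynomial_ring V)"
proof -
  have "0 \<in> carrier (polynomial_ring V)" by (simp add: carrier_polynomial_ring)
  then show ?thesis
    using assms
    by (induction A rule: infinite_finite_induct) (auto simp: polynomial_ring_add_closed)
qed

lemma SR_generators_in_carrier: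
  "{\<Prod>i\<in>S. Var i | S. S \<subseteq> V \<and> S \<notin> \<Delta>} \<subseteq> carrier (polynomial_ring V)"
proof
  fix x :: "'a rpoly" assume "x \<in> {\<Prod>i\<in>S. Var i | S. S \<subseteq> V \<and> S \<notin> \<Delta>}"
  then obtain T where T: "x = (\<Prod>i\<in>T. Var i)" "T \<subseteq> V" by blast
  show "x \<in> carrier (polynomial_ring V)"
    unfolding T(1) by (rule prod_in_carrier) (use T(2) in \<open>auto intro: Var_in_carrier\<close>)
qed

lemma ring_polynomial_ring: "ring (polynomial_ring V)"
  using cring_polynomial_ring by (rule cring.axioms(1))

lemma ideal_SR_ideal: "ideal (SR_ideal V \<Delta>) (polynomial_ring V)"
  unfolding SR_ideal_def
  by (rule ring.genideal_ideal[OF ring_polynomial_ring SR_generators_in_carrier])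

lemma nonface_in_SR_ideal:
  assumes "S \<subseteq> V" "S \<notin> \<Delta>"
  shows "(\<Prod>i\<in>S. Var i) \<in> SR_ideal V \<Delta>"
  unfolding SR_ideal_def
  by (rule subsetD[OF ring.genideal_self[OF ring_polynomial_ring SR_generators_in_carrier]])
     (use assms in auto)

lemma SR_ideal_add:
  assumes "p \<in> SR_ideal V \<Delta>" "q \<in> SR_ideal V \<Delta>"
  shows "p + q \<in> SR_ideal V \<Delta>"
  using additive_subgroup.a_closed[OF ideal.axioms(1)[OF ideal_SR_ideal] assms] by simp

lemma zero_in_SR_ideal: "0 \<in> SR_ideal V \<Delta>"
  using additive_subgroup.zero_closed[OF ideal.axioms(1)[OF ideal_SR_ideal]] by simp

lemma SR_ideal_sum:
  assumes "\<And>i. i \<in> A \<Longrightarrow> f i \<in> SR_ideal V \<Delta>"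
  shows "(\<Sum>i\<in>A. f i) \<in> SR_ideal V \<Delta>"
  using assms
  by (induction A rule: infinite_finite_induct) (auto simp: zero_in_SR_ideal SR_ideal_add)

lemma SR_ideal_mult:
  assumes "p \<in> SR_ideal V \<Delta>" "q \<in> carrier (polynomial_ring V)"
  shows "q * p \<in> SR_ideal V \<Delta>"
  using ideal.I_l_closed[OF ideal_SR_ideal assms] by simp

lemma face_vectors_iff:
  assumes "simplicial_complex V \<Delta>"
  shows "v \<in> face_vectors \<Delta> \<longleftrightarrow> (\<exists>F\<in>\<Delta>. \<forall>i. i \<notin> F \<longrightarrow> v i = 0)"
proof -
  have "(\<exists>c. v = (\<lambda>j. \<Sum>i\<in>F. c i * unit_vec i j)) \<longleftrightarrow> (\<forall>i. i \<notin> F \<longrightarrow> v i = 0)"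
    if F: "F \<in> \<Delta>" for F
  proof -
    have "finite F"
      using F assms unfolding simplicial_complex_def by (meson PowD finite_subset subsetD)
    then have eq: "(\<Sum>i\<in>F. c i * unit_vec i j) = (if j \<in> F then c j else 0)" for c j
      by (simp add: unit_vec_def if_distrib cong: if_cong)
    show ?thesis
      unfolding eq by (auto simp: fun_eq_iff)
  qed
  then show ?thesis
    by (simp add: face_vectors_def)
qed

lemma SR_ideal_vanishes:
  assumes S: "simplicial_complex V \<Delta>" and p: "p \<in> SR_ideal V \<Delta>" and v: "v \<in> face_vectors \<Delta>"
  shows "poly_eval p v = 0"
proof -
  interpret cring "polynomial_ring V" by (rule cring_polynomial_ring)
  let ?J = "{p \<in> carrier (polynomial_ring V). poly_eval p v = 0}"
  have "ideal ?J (polynomial_ring V)"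
  proof (rule idealI[OF ring_axioms])
    show "subgroup ?J (add_monoid (polynomial_ring V))"
    proof (rule add.subgroupI)
      fix a assume a: "a \<in> ?J"
      have "\<ominus>\<^bsub>polynomial_ring V\<^esub> a = - a"
        using a a_minus_polynomial_ring[of 0 V a] by (simp add: a_minus_def carrier_polynomial_ring)
      then show "\<ominus>\<^bsub>polynomial_ring V\<^esub> a \<in> ?J"
        using a by (simp add: carrier_polynomial_ring poly_eval_uminus)
    next
      show "?J \<noteq> {}" by (auto intro!: exI[of _ 0] simp: carrier_polynomial_ring)
    qed (auto simp: poly_eval_add polynomial_ring_add_closed)
  qed (auto simp: poly_eval_mult polynomial_ring_mult_closed)
  moreover have "{\<Prod>i\<in>S. Var i | S. S \<subseteq> V \<and> S \<notin> \<Delta>} \<subseteq> ?J"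
  proof
    fix x assume "x \<in> {\<Prod>i\<in>S. Var i | S. S \<subseteq> V \<and> S \<notin> \<Delta>}"
    then obtain T where T: "x = (\<Prod>i\<in>T. Var i)" "T \<subseteq> V" "T \<notin> \<Delta>" by blast
    obtain F where F: "F \<in> \<Delta>" "\<forall>i. i \<notin> F \<longrightarrow> v i = 0"
      using v face_vectors_iff[OF S] by blast
    have "\<not> T \<subseteq> F" using F(1) T(3) S unfolding simplicial_complex_def by blast
    then obtain i where i: "i \<in> T" "i \<notin> F" by blast
    have "finite T" using T(2) S by (auto simp: simplicial_complex_def intro: finite_subset)
    then have "poly_eval x v = 0"
      using i F(2) by (auto simp: T(1) poly_eval_prod)
    moreover have "x \<in> carrier (polynomial_ring V)"
      unfolding T(1) by (rule prod_in_carrier) (use T(2) in \<open>auto intro: Var_in_carrier\<close>)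
    ultimately show "x \<in> ?J" by simp
  qed
  ultimately have "SR_ideal V \<Delta> \<subseteq> ?J"
    unfolding SR_ideal_def by (rule genideal_minimal)
  then show ?thesis using p by blast
qed

lemma SR_class_eq_iff:
  assumes "p \<in> carrier (polynomial_ring V)" "q \<in> carrier (polynomial_ring V)"
  shows "SR_class V \<Delta> p = SR_class V \<Delta> q \<longleftrightarrow> p - q \<in> SR_ideal V \<Delta>"
proof -
  interpret cring "polynomial_ring V" by (rule cring_polynomial_ring)
  show ?thesis
    unfolding SR_class_def
    using quotient_eq_iff_same_a_r_cos[OF ideal_SR_ideal assms] a_minus_polynomial_ring[OF assms]
    by simp
qed

lemma SR_eval_class:
  assumes "simplicial_complex V \<Delta>" "v \<in> face_vectors \<Delta>"
  shows "SR_eval (SR_class V \<Delta> p) v = poly_eval p v"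
proof -
  have "SR_class V \<Delta> p = (\<lambda>h. h + p) ` SR_ideal V \<Delta>"
    by (auto simp: SR_class_def a_r_coset_def')
  then have "(\<lambda>p. poly_eval p v) ` SR_class V \<Delta> p = {poly_eval p v}"
    using zero_in_SR_ideal[of V \<Delta>] SR_ideal_vanishes[OF assms(1) _ assms(2)]
    by (auto simp: poly_eval_add image_image)
  then show ?thesis by (simp add: SR_eval_def)
qed

lemma SR_algebra_zero: "\<zero>\<^bsub>SR_algebra V \<Delta>\<^esub> = SR_class V \<Delta> 0"
proof -
  interpret cring "polynomial_ring V" by (rule cring_polynomial_ring)
  have "SR_ideal V \<Delta> \<subseteq> carrier (polynomial_ring V)"
    using additive_subgroup.a_subset[OF ideal.axioms(1)[OF ideal_SR_ideal]] .
  then show ?thesis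
    using a_coset_add_zero by (simp add: SR_algebra_def SR_class_def FactRing_def)
qed

lemma SR_algebra_add:
  assumes "p \<in> carrier (polynomial_ring V)" "q \<in> carrier (polynomial_ring V)"
  shows "SR_class V \<Delta> p \<oplus>\<^bsub>SR_algebra V \<Delta>\<^esub> SR_class V \<Delta> q = SR_class V \<Delta> (p + q)"
  using ideal.a_rcos_sum[OF ideal_SR_ideal assms]
  by (simp add: SR_algebra_def SR_class_def FactRing_def)

lemma SR_algebra_smult:
  assumes "p \<in> carrier (polynomial_ring V)"
  shows "c \<odot>\<^bsub>SR_algebra V \<Delta>\<^esub> SR_class V \<Delta> p = SR_class V \<Delta> (Const c * p)"
  using ideal.rcoset_mult_add[OF ideal_SR_ideal Const_in_carrier assms]
  by (simp add: SR_algebra_def SR_class_def FactRing_def Let_def)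

section \<open>Degree two classes as quadratic forms\<close>

definition quad_poly :: "'a set \<Rightarrow> ('a \<Rightarrow> 'a \<Rightarrow> real) \<Rightarrow> 'a rpoly" where
  "quad_poly V g = (\<Sum>i\<in>V. \<Sum>j\<in>V. Const (g i j) * (Var i * Var j))"

definition quad_form :: "'a set \<Rightarrow> ('a \<Rightarrow> 'a \<Rightarrow> real) \<Rightarrow> ('a \<Rightarrow> real) \<Rightarrow> real" where
  "quad_form V g v = (\<Sum>i\<in>V. \<Sum>j\<in>V. g i j * (v i * v j))"

lemma poly_eval_quad_poly [simp]: "poly_eval (quad_poly V g) v = quad_form V g v"
  by (simp add: quad_poly_def quad_form_def poly_eval_sum poly_eval_mult Const_def)

lemma quad_poly_in_carrier: "quad_poly V g \<in> carrier (polynomial_ring V)"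
  unfolding quad_poly_def
  by (intro sum_in_carrier polynomial_ring_mult_closed Const_in_carrier Var_in_carrier)

lemma Const_mult_Var_Var:
  "Const c * (Var i * Var j) =
    Poly_Mapping.single (Poly_Mapping.single i 1 + Poly_Mapping.single j 1) c"
  by (simp add: Const_def Var_def mult_single)

lemma homogeneous_add:
  assumes "homogeneous d p" "homogeneous d q"
  shows "homogeneous d (p + q)"
  using assms keys_add[of p q] unfolding homogeneous_def by blast

lemma homogeneous_sum:
  assumes "\<And>i. i \<in> A \<Longrightarrow> homogeneous d (f i)"
  shows "homogeneous d (\<Sum>i\<in>A. f i)"
  using assms
  by (induction A rule: infinite_finite_induct) (auto simp: homogeneous_add, auto simp: homogeneous_def)

lemma degree_add:
  fixes m n :: "'a \<Rightarrow>\<^sub>0 nat"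
  shows "(\<Sum>i\<in>Poly_Mapping.keys (m + n). Poly_Mapping.lookup (m + n) i) =
    (\<Sum>i\<in>Poly_Mapping.keys m. Poly_Mapping.lookup m i) +
    (\<Sum>i\<in>Poly_Mapping.keys n. Poly_Mapping.lookup n i)"
  by (rule setsum_keys_plus_distrib) auto

lemma homogeneous_quad_poly: "homogeneous 2 (quad_poly V g)"
  unfolding quad_poly_def Const_mult_Var_Var
  by (intro homogeneous_sum) (auto simp: homogeneous_def degree_add)

lemma monomial_split:
  fixes m :: "'a \<Rightarrow>\<^sub>0 nat"
  assumes "i \<in> Poly_Mapping.keys m"
  shows "m = Poly_Mapping.single i 1 + (m - Poly_Mapping.single i 1)"
  using assms
  by (intro poly_mapping_eqI) (auto simp: lookup_add lookup_minus lookup_single when_def in_keys_iff)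

lemma degree_two_monomial:
  fixes m :: "'a \<Rightarrow>\<^sub>0 nat"
  assumes "(\<Sum>i\<in>Poly_Mapping.keys m. Poly_Mapping.lookup m i) = 2"
  obtains i j where "m = Poly_Mapping.single i 1 + Poly_Mapping.single j 1"
    "i \<in> Poly_Mapping.keys m" "j \<in> Poly_Mapping.keys m"
proof -
  let ?deg = "\<lambda>m::'a \<Rightarrow>\<^sub>0 nat. \<Sum>i\<in>Poly_Mapping.keys m. Poly_Mapping.lookup m i"
  have deg: "?deg (Poly_Mapping.single i 1 + n) = 1 + ?deg n" for i n
    by (subst degree_add) simp
  from assms obtain i where i: "i \<in> Poly_Mapping.keys m" by fastforce
  define n where "n = m - Poly_Mapping.single i 1"
  have m: "m = Poly_Mapping.single i 1 + n" unfolding n_def by (rule monomial_split[OF i])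
  then have "?deg n = 1" using assms deg[of i n] by simp
  then obtain j where j: "j \<in> Poly_Mapping.keys n" by fastforce
  define k where "k = n - Poly_Mapping.single j 1"
  have n: "n = Poly_Mapping.single j 1 + k" unfolding k_def by (rule monomial_split[OF j])
  then have "?deg k = 0" using \<open>?deg n = 1\<close> deg[of j k] by simp
  then have "k = 0" by (auto simp: in_keys_iff intro!: poly_mapping_eqI)
  then have "m = Poly_Mapping.single i 1 + Poly_Mapping.single j 1" using m n by simp
  moreover from this have "j \<in> Poly_Mapping.keys m" by (simp add: in_keys_iff lookup_add)
  ultimately show thesis using that i by blast
qed

lemma quad_poly_add: "quad_poly V g + quad_poly V h = quad_poly V (\<lambda>i j. g i j + h i j)"
  by (simp add: quad_poly_def Const_def single_add distrib_right sum.distrib)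

lemma quad_poly_single:
  assumes "finite V" "i \<in> V" "j \<in> V"
  shows "Poly_Mapping.single (Poly_Mapping.single i 1 + Poly_Mapping.single j 1) c =
    quad_poly V (\<lambda>k l. if k = i then (if l = j then c else 0) else 0)"
proof -
  have "Const (if k = i then (if l = j then c else 0) else 0) * (Var k * Var l) =
    (if k = i then (if l = j then Const c * (Var i * Var j) else 0) else 0)" for k l
    by (auto simp: Const_def)
  then have "quad_poly V (\<lambda>k l. if k = i then (if l = j then c else 0) else 0) =
    (\<Sum>k\<in>V. if k = i then (\<Sum>l\<in>V. if l = j then Const c * (Var i * Var j) else 0) else 0)"
    unfolding quad_poly_def by (intro sum.cong) auto
  then show ?thesis
    using assms by (simp add: Const_mult_Var_Var)
qed

lemma homogeneous_two_quad_poly: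
  assumes V: "finite V" and p: "p \<in> carrier (polynomial_ring V)" "homogeneous 2 p"
  obtains g where "p = quad_poly V g" "\<And>i j. g i j = g j i"
proof -
  have "\<exists>g. (\<Sum>m\<in>M. Poly_Mapping.single m (Poly_Mapping.lookup p m)) = quad_poly V g"
    if "M \<subseteq> Poly_Mapping.keys p" for M
    using finite_subset[OF that finite_keys] that
  proof (induction M rule: finite_induct)
    case empty
    have "quad_poly V (\<lambda>_ _. 0) = 0" by (simp add: quad_poly_def Const_def)
    then show ?case by (metis sum.empty)
  next
    case (insert m M)
    obtain i j where m: "m = Poly_Mapping.single i 1 + Poly_Mapping.single j 1"
      "i \<in> Poly_Mapping.keys m" "j \<in> Poly_Mapping.keys m"
      using p(2) insert.prems degree_two_monomial[of m] unfolding homogeneous_def by blast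
    moreover have "Poly_Mapping.keys m \<subseteq> V"
      using p(1) insert.prems unfolding carrier_polynomial_ring by blast
    ultimately obtain g where "Poly_Mapping.single m (Poly_Mapping.lookup p m) = quad_poly V g"
      using quad_poly_single[OF V] by blast
    then show ?case
      using insert by (auto simp: quad_poly_add)
  qed
  then obtain g where g: "p = quad_poly V g"
    using poly_mapping_sum_singles[of p] by fastforce
  let ?h = "\<lambda>i j. g i j / 2" and ?k = "\<lambda>i j. g j i / 2"
  have "quad_poly V ?k = quad_poly V ?h"
    unfolding quad_poly_def by (subst sum.swap) (simp add: mult.commute)
  then have "quad_poly V (\<lambda>i j. ?h i j + ?k i j) = quad_poly V (\<lambda>i j. ?h i j + ?h i j)"
    by (simp only: quad_poly_add[symmetric])
  then have "p = quad_poly V (\<lambda>i j. ?h i j + ?k i j)" using g by simp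
  then show thesis by (rule that) simp
qed

lemma R2_quad_form:
  assumes S: "simplicial_complex V \<Delta>" and X: "X \<in> R2 V \<Delta>"
  obtains g where "X = SR_class V \<Delta> (quad_poly V g)" "\<And>i j. g i j = g j i"
    "\<And>v. v \<in> face_vectors \<Delta> \<Longrightarrow> SR_eval X v = quad_form V g v"
proof -
  from X obtain p where p: "p \<in> carrier (polynomial_ring V)" "homogeneous 2 p" "X = SR_class V \<Delta> p"
    unfolding R2_def by blast
  have "finite V" using S unfolding simplicial_complex_def by blast
  from homogeneous_two_quad_poly[OF this p(1,2)] obtain g
    where "p = quad_poly V g" "\<And>i j. g i j = g j i" by blast
  then show thesis using p(3) SR_eval_class[OF S] by (intro that[of g]) auto
qed

lemma SR_class_quad_poly_R2: "SR_class V \<Delta> (quad_poly V g) \<in> R2 V \<Delta>"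
  unfolding R2_def using quad_poly_in_carrier homogeneous_quad_poly by blast

lemma quad_form_vanishing_coeff:
  assumes S: "simplicial_complex V \<Delta>" and sym: "\<And>i j. g i j = g j i"
    and zero: "\<And>v. v \<in> face_vectors \<Delta> \<Longrightarrow> quad_form V g v = 0" and ij: "{i, j} \<in> \<Delta>"
  shows "g i j = 0"
proof -
  have V: "finite V" "i \<in> V" "j \<in> V" using S ij unfolding simplicial_complex_def by auto
  have diag: "g k k = 0" if "k \<in> {i, j}" for k
  proof -
    have "quad_form V g (\<lambda>l. if l = k then 1 else 0) =
      (\<Sum>a\<in>V. if a = k then (\<Sum>b\<in>V. if b = k then g k k else 0) else 0)"
      unfolding quad_form_def by (intro sum.cong) (auto intro: sum.cong)
    then have "quad_form V g (\<lambda>l. if l = k then 1 else 0) = g k k"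
      using V that by auto
    moreover have "(\<lambda>l. if l = k then 1 else 0) \<in> face_vectors \<Delta>"
      unfolding face_vectors_iff[OF S] using ij that by (intro bexI[of _ "{i, j}"]) auto
    ultimately show ?thesis using zero by metis
  qed
  show ?thesis
  proof (cases "i = j")
    case False
    let ?v = "\<lambda>l. if l = i then 1 else if l = j then 1 else 0 :: real"
    have *: "(\<Sum>l\<in>V. h l * ?v l) = h i + h j" for h
    proof -
      have "(\<Sum>l\<in>V. h l * ?v l) = (\<Sum>l\<in>V. (if l = i then h l else 0) + (if l = j then h l else 0))"
        using False by (intro sum.cong) auto
      then show ?thesis using V by (simp add: sum.distrib)
    qed
    have "quad_form V g ?v = (\<Sum>k\<in>V. (\<Sum>l\<in>V. g k l * ?v l) * ?v k)"
      unfolding quad_form_def sum_distrib_right by (simp add: mult_ac)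
    also have "\<dots> = g i i + g i j + (g j i + g j j)" unfolding * by simp
    finally have "quad_form V g ?v = g i i + g i j + (g j i + g j j)" .
    moreover have "?v \<in> face_vectors \<Delta>"
      unfolding face_vectors_iff[OF S] using ij by (intro bexI[of _ "{i, j}"]) auto
    ultimately show ?thesis using zero[of ?v] diag sym[of i j] by simp
  qed (use diag in simp)
qed

lemma R2_eqI:
  assumes S: "simplicial_complex V \<Delta>" and XY: "X \<in> R2 V \<Delta>" "Y \<in> R2 V \<Delta>"
    and eq: "\<And>v. v \<in> face_vectors \<Delta> \<Longrightarrow> SR_eval X v = SR_eval Y v"
  shows "X = Y"
proof -
  from R2_quad_form[OF S XY(1)] obtain g where
    g: "X = SR_class V \<Delta> (quad_poly V g)" "\<And>i j. g i j = g j i"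
      "\<And>v. v \<in> face_vectors \<Delta> \<Longrightarrow> SR_eval X v = quad_form V g v" by blast
  from R2_quad_form[OF S XY(2)] obtain h where
    h: "Y = SR_class V \<Delta> (quad_poly V h)" "\<And>i j. h i j = h j i"
      "\<And>v. v \<in> face_vectors \<Delta> \<Longrightarrow> SR_eval Y v = quad_form V h v" by blast
  define d where "d = (\<lambda>i j. g i j - h i j)"
  have split: "quad_poly V g = quad_poly V d + quad_poly V h"
    by (simp add: quad_poly_add d_def)
  have zero: "quad_form V d v = 0" if "v \<in> face_vectors \<Delta>" for v
    using g(3)[OF that] h(3)[OF that] eq[OF that] arg_cong[OF split, of "\<lambda>p. poly_eval p v"]
    by (simp add: poly_eval_add)
  have "Const (d i j) * (Var i * Var j) \<in> SR_ideal V \<Delta>" if ij: "i \<in> V" "j \<in> V" for i j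
  proof (cases "{i, j} \<in> \<Delta>")
    case True
    have "d i j = 0"
      by (rule quad_form_vanishing_coeff[OF S _ zero True])
         (metis d_def g(2) h(2))
    then show ?thesis by (simp add: Const_def zero_in_SR_ideal)
  next
    case False
    then have "i \<noteq> j" using S ij unfolding simplicial_complex_def by auto
    then have "Var i * Var j = (\<Prod>k\<in>{i, j}. Var k)" by simp
    then show ?thesis
      using SR_ideal_mult[OF nonface_in_SR_ideal[of "{i, j}" V \<Delta>] Const_in_carrier] False ij by auto
  qed
  then have "quad_poly V d \<in> SR_ideal V \<Delta>"
    unfolding quad_poly_def by (intro SR_ideal_sum)
  then show ?thesis
    unfolding g(1) h(1) SR_class_eq_iff[OF quad_poly_in_carrier quad_poly_in_carrier]
    by (simp add: split)
qed

lemma Const_mult_quad_poly: "Const c * quad_poly V g = quad_poly V (\<lambda>i j. c * g i j)"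
  by (simp add: quad_poly_def sum_distrib_left Const_def mult_single flip: mult.assoc)

lemma R2_add:
  assumes S: "simplicial_complex V \<Delta>" and X: "X \<in> R2 V \<Delta>" and Y: "Y \<in> R2 V \<Delta>"
  shows "X \<oplus>\<^bsub>SR_algebra V \<Delta>\<^esub> Y \<in> R2 V \<Delta>"
    and "v \<in> face_vectors \<Delta> \<Longrightarrow>
      SR_eval (X \<oplus>\<^bsub>SR_algebra V \<Delta>\<^esub> Y) v = SR_eval X v + SR_eval Y v"
proof -
  obtain g where g: "X = SR_class V \<Delta> (quad_poly V g)" using R2_quad_form[OF S X] by blast
  obtain h where h: "Y = SR_class V \<Delta> (quad_poly V h)" using R2_quad_form[OF S Y] by blast
  have eq: "X \<oplus>\<^bsub>SR_algebra V \<Delta>\<^esub> Y = SR_class V \<Delta> (quad_poly V g + quad_poly V h)"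
    unfolding g h by (rule SR_algebra_add[OF quad_poly_in_carrier quad_poly_in_carrier])
  show "X \<oplus>\<^bsub>SR_algebra V \<Delta>\<^esub> Y \<in> R2 V \<Delta>"
    unfolding eq quad_poly_add by (rule SR_class_quad_poly_R2)
  show "SR_eval (X \<oplus>\<^bsub>SR_algebra V \<Delta>\<^esub> Y) v = SR_eval X v + SR_eval Y v"
    if "v \<in> face_vectors \<Delta>"
    unfolding eq using SR_eval_class[OF S that] by (simp add: g h poly_eval_add)
qed

lemma R2_smult:
  assumes S: "simplicial_complex V \<Delta>" and X: "X \<in> R2 V \<Delta>"
  shows "c \<odot>\<^bsub>SR_algebra V \<Delta>\<^esub> X \<in> R2 V \<Delta>"
    and "v \<in> face_vectors \<Delta> \<Longrightarrow> SR_eval (c \<odot>\<^bsub>SR_algebra V \<Delta>\<^esub> X) v = c * SR_eval X v"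
proof -
  obtain g where g: "X = SR_class V \<Delta> (quad_poly V g)" using R2_quad_form[OF S X] by blast
  have eq: "c \<odot>\<^bsub>SR_algebra V \<Delta>\<^esub> X = SR_class V \<Delta> (Const c * quad_poly V g)"
    unfolding g by (rule SR_algebra_smult[OF quad_poly_in_carrier])
  show "c \<odot>\<^bsub>SR_algebra V \<Delta>\<^esub> X \<in> R2 V \<Delta>"
    unfolding eq Const_mult_quad_poly by (rule SR_class_quad_poly_R2)
  show "SR_eval (c \<odot>\<^bsub>SR_algebra V \<Delta>\<^esub> X) v = c * SR_eval X v" if "v \<in> face_vectors \<Delta>"
    unfolding eq using SR_eval_class[OF S that] by (simp add: g poly_eval_mult Const_def)
qed

lemma R2_zero:
  assumes S: "simplicial_complex V \<Delta>"
  shows "\<zero>\<^bsub>SR_algebra V \<Delta>\<^esub> \<in> R2 V \<Delta>"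
    and "v \<in> face_vectors \<Delta> \<Longrightarrow> SR_eval \<zero>\<^bsub>SR_algebra V \<Delta>\<^esub> v = 0"
proof -
  have "quad_poly V (\<lambda>_ _. 0) = 0" by (simp add: quad_poly_def Const_def)
  then show "\<zero>\<^bsub>SR_algebra V \<Delta>\<^esub> \<in> R2 V \<Delta>"
    unfolding SR_algebra_zero by (metis SR_class_quad_poly_R2)
  show "SR_eval \<zero>\<^bsub>SR_algebra V \<Delta>\<^esub> v = 0" if "v \<in> face_vectors \<Delta>"
    unfolding SR_algebra_zero SR_eval_class[OF S that] by simp
qed

lemma lin_indep_pair_R2_iff:
  assumes S: "simplicial_complex V \<Delta>" and X: "X \<in> R2 V \<Delta>" and Y: "Y \<in> R2 V \<Delta>"
  shows "lin_indep_pair (SR_algebra V \<Delta>) X Y \<longleftrightarrow>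
    (\<forall>a b. (\<forall>v\<in>face_vectors \<Delta>. a * SR_eval X v + b * SR_eval Y v = 0) \<longrightarrow> a = 0 \<and> b = 0)"
proof -
  have "(a \<odot>\<^bsub>SR_algebra V \<Delta>\<^esub> X) \<oplus>\<^bsub>SR_algebra V \<Delta>\<^esub> (b \<odot>\<^bsub>SR_algebra V \<Delta>\<^esub> Y) = \<zero>\<^bsub>SR_algebra V \<Delta>\<^esub> \<longleftrightarrow>
    (\<forall>v\<in>face_vectors \<Delta>. a * SR_eval X v + b * SR_eval Y v = 0)" (is "?L \<longleftrightarrow> ?R") for a b
  proof
    assume ?L
    then show ?R
      using R2_add(2)[OF S R2_smult(1)[OF S X] R2_smult(1)[OF S Y]] R2_smult(2)[OF S X]
        R2_smult(2)[OF S Y] R2_zero(2)[OF S] by metis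
  next
    assume ?R
    then show ?L
      by (intro R2_eqI[OF S] R2_add(1) R2_smult(1) R2_zero(1) S X Y)
         (simp add: R2_add(2) R2_smult R2_zero(2) S X Y)
  qed
  then show ?thesis unfolding lin_indep_pair_def by simp
qed

section \<open>Pullback along a simplicial map\<close>

lemma surjective_simplicial_mapD:
  assumes "surjective_simplicial_map V \<Delta> W \<Gamma> \<phi>"
  shows "\<phi> ` V \<subseteq> W" "F \<in> \<Delta> \<Longrightarrow> \<phi> ` F \<in> \<Gamma>" "G \<in> \<Gamma> \<Longrightarrow> \<exists>F\<in>\<Delta>. \<phi> ` F = G"
  using assms unfolding surjective_simplicial_map_def simplicial_map_def by auto

lemma induced_linear_face_vectors:
  assumes S: "simplicial_complex V \<Delta>" and T: "simplicial_complex W \<Gamma>"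
    and \<phi>: "surjective_simplicial_map V \<Delta> W \<Gamma> \<phi>" and v: "v \<in> face_vectors \<Delta>"
  shows "induced_linear V \<phi> v \<in> face_vectors \<Gamma>"
proof -
  obtain F where F: "F \<in> \<Delta>" "\<forall>i. i \<notin> F \<longrightarrow> v i = 0"
    using v face_vectors_iff[OF S] by blast
  have "\<forall>j. j \<notin> \<phi> ` F \<longrightarrow> induced_linear V \<phi> v j = 0"
    using F(2) by (auto simp: induced_linear_def unit_vec_def intro!: sum.neutral) (metis imageI)
  then show ?thesis
    unfolding face_vectors_iff[OF T] using surjective_simplicial_mapD(2)[OF \<phi> F(1)] by blast
qed

lemma face_vectors_lift:
  assumes S: "simplicial_complex V \<Delta>" and T: "simplicial_complex W \<Gamma>"
    and \<phi>: "surjective_simplicial_map V \<Delta> W \<Gamma> \<phi>" and w: "w \<in> face_vectors \<Gamma>"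
  obtains v where "v \<in> face_vectors \<Delta>" "induced_linear V \<phi> v = w"
proof -
  obtain G where G: "G \<in> \<Gamma>" "\<forall>i. i \<notin> G \<longrightarrow> w i = 0"
    using w face_vectors_iff[OF T] by blast
  obtain F where F: "F \<in> \<Delta>" "\<phi> ` F = G"
    using surjective_simplicial_mapD(3)[OF \<phi> G(1)] by blast
  then obtain E where E: "E \<subseteq> F" "inj_on \<phi> E" "G = \<phi> ` E"
    using subset_image_inj[of G \<phi> F] by auto
  have V: "finite V" "E \<subseteq> V" using S E(1) F(1) unfolding simplicial_complex_def by auto
  define v where "v i = (if i \<in> E then w (\<phi> i) else 0)" for i
  have "induced_linear V \<phi> v j = w j" for j
  proof -
    have "induced_linear V \<phi> v j = (\<Sum>i\<in>E. w (\<phi> i) * unit_vec (\<phi> i) j)"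
      unfolding induced_linear_def
      by (rule sum.mono_neutral_cong_right) (use V in \<open>auto simp: v_def\<close>)
    also have "\<dots> = (\<Sum>k\<in>G. w k * unit_vec k j)"
      unfolding E(3) by (simp add: sum.reindex[OF E(2)])
    also have "\<dots> = (\<Sum>k\<in>G. if k = j then w j else 0)"
      by (rule sum.cong) (auto simp: unit_vec_def)
    also have "\<dots> = w j"
      using G(2) E(3) finite_subset[OF V(2,1)] by auto
    finally show ?thesis .
  qed
  moreover have "v \<in> face_vectors \<Delta>"
    unfolding face_vectors_iff[OF S] using F(1) E(1) by (auto simp: v_def)
  ultimately show thesis using that by blast
qed

lemma quad_form_altdef: "quad_form V g v = (\<Sum>i\<in>V. (\<Sum>j\<in>V. g i j * v j) * v i)"
  by (simp add: quad_form_def sum_distrib_left sum_distrib_right mult_ac)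

lemma sum_unit_vec:
  assumes "finite A" "a \<in> A"
  shows "(\<Sum>l\<in>A. k l * unit_vec a l) = k a"
proof -
  have "(\<Sum>l\<in>A. k l * unit_vec a l) = (\<Sum>l\<in>A. if l = a then k a else 0)"
    by (rule sum.cong) (auto simp: unit_vec_def)
  then show ?thesis using assms by simp
qed

lemma quad_form_induced_linear:
  assumes W: "finite W" and \<phi>: "\<phi> ` V \<subseteq> W"
  shows "quad_form W h (induced_linear V \<phi> v) = quad_form V (\<lambda>i j. h (\<phi> i) (\<phi> j)) v"
proof -
  have "(\<Sum>c\<in>W. k c * induced_linear V \<phi> v c) = (\<Sum>i\<in>V. k (\<phi> i) * v i)" for k
  proof -
    have "(\<Sum>c\<in>W. k c * induced_linear V \<phi> v c) = (\<Sum>i\<in>V. \<Sum>c\<in>W. k c * unit_vec (\<phi> i) c * v i)"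
      unfolding induced_linear_def sum_distrib_left by (subst sum.swap) (simp add: mult_ac)
    also have "\<dots> = (\<Sum>i\<in>V. k (\<phi> i) * v i)"
      using \<phi> by (intro sum.cong) (auto simp: sum_unit_vec[OF W] simp flip: sum_distrib_right)
    finally show ?thesis .
  qed
  then show ?thesis unfolding quad_form_altdef by simp
qed

lemma pullback_R2:
  assumes S: "simplicial_complex V \<Delta>" and T: "simplicial_complex W \<Gamma>"
    and \<phi>: "surjective_simplicial_map V \<Delta> W \<Gamma> \<phi>" and q: "q \<in> R2 W \<Gamma>"
  shows "pullback V \<Delta> \<phi> q \<in> R2 V \<Delta>"
    and "v \<in> face_vectors \<Delta> \<Longrightarrow> SR_eval (pullback V \<Delta> \<phi> q) v = SR_eval q (induced_linear V \<phi> v)"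
proof -
  let ?P = "\<lambda>X. X \<in> R2 V \<Delta> \<and>
    (\<forall>v\<in>face_vectors \<Delta>. SR_eval X v = SR_eval q (induced_linear V \<phi> v))"
  obtain h where h: "\<And>w. w \<in> face_vectors \<Gamma> \<Longrightarrow> SR_eval q w = quad_form W h w"
    using R2_quad_form[OF T q] by blast
  have W: "finite W" using T unfolding simplicial_complex_def by blast
  let ?X = "SR_class V \<Delta> (quad_poly V (\<lambda>i j. h (\<phi> i) (\<phi> j)))"
  have "SR_eval ?X v = SR_eval q (induced_linear V \<phi> v)" if v: "v \<in> face_vectors \<Delta>" for v
    using quad_form_induced_linear[OF W surjective_simplicial_mapD(1)[OF \<phi>], of h v]
    by (simp add: SR_eval_class[OF S v] h[OF induced_linear_face_vectors[OF S T \<phi> v]])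
  then have ex: "?P ?X" using SR_class_quad_poly_R2 by blast
  have unique: "Y = ?X" if "?P Y" for Y
  proof (rule R2_eqI[OF S])
    fix v assume v: "v \<in> face_vectors \<Delta>"
    show "SR_eval Y v = SR_eval ?X v"
      using bspec[OF conjunct2[OF that] v] bspec[OF conjunct2[OF ex] v] by (rule trans[OF _ sym])
  qed (rule conjunct1[OF that], rule conjunct1[OF ex])
  have P: "?P (pullback V \<Delta> \<phi> q)"
    unfolding pullback_def by (rule theI[of ?P, OF ex unique])
  show "pullback V \<Delta> \<phi> q \<in> R2 V \<Delta>"
    by (rule conjunct1[OF P])
  show "SR_eval (pullback V \<Delta> \<phi> q) v = SR_eval q (induced_linear V \<phi> v)"
    if "v \<in> face_vectors \<Delta>"
    by (rule bspec[OF conjunct2[OF P] that])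
qed

section \<open>Forms dominated by a pullback\<close>

lemma affine_nonneg_imp_slope_zero:
  fixes x z :: real
  assumes "\<And>t. 0 \<le> t * x + z"
  shows "x = 0"
proof (rule ccontr)
  assume "x \<noteq> 0"
  then show False using assms[of "- (z + 1) / x"] by simp
qed

text \<open>\<open>e\<^sub>a - e\<^sub>b\<close> is mapped to zero, so the dominated form vanishes on it; by nonnegativity on the
  span of the face it then lies in the kernel of the bilinear form there.\<close>

lemma dominated_coeff_eq:
  assumes S: "simplicial_complex V \<Delta>" and sym: "\<And>i j. g i j = g j i"
    and nonneg: "\<And>v. v \<in> face_vectors \<Delta> \<Longrightarrow> 0 \<le> quad_form V g v"
    and le: "\<And>v. v \<in> face_vectors \<Delta> \<Longrightarrow> quad_form V g v \<le> quad_form W h (induced_linear V \<phi> v)"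
    and face: "{a, b, c} \<in> \<Delta>" and ab: "\<phi> a = \<phi> b"
  shows "g a c = g b c"
proof -
  have V: "finite V" "a \<in> V" "b \<in> V" "c \<in> V"
    using S face unfolding simplicial_complex_def by auto
  define u where "u s t l = t * (unit_vec a l - unit_vec b l) + s * unit_vec c l" for s t :: real and l
  have fv: "u s t \<in> face_vectors \<Delta>" for s t
    unfolding face_vectors_iff[OF S] using face
    by (intro bexI[of _ "{a, b, c}"]) (auto simp: u_def unit_vec_def)
  have lin: "(\<Sum>l\<in>V. k l * u s t l) = t * (k a - k b) + s * k c" for k s t
  proof -
    have "(\<Sum>l\<in>V. k l * u s t l) =
      t * ((\<Sum>l\<in>V. k l * unit_vec a l) - (\<Sum>l\<in>V. k l * unit_vec b l)) + s * (\<Sum>l\<in>V. k l * unit_vec c l)"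
      unfolding u_def sum_subtractf[symmetric] sum_distrib_left sum.distrib[symmetric]
      by (simp add: algebra_simps)
    then show ?thesis using V by (simp add: sum_unit_vec)
  qed
  have q: "quad_form V g (u s t) =
    t\<^sup>2 * (g a a - 2 * g a b + g b b) + 2 * s * t * (g a c - g b c) + s\<^sup>2 * g c c" for s t
    unfolding quad_form_altdef lin
    by (simp add: sym[of b a] sym[of c a] sym[of c b] algebra_simps power2_eq_square)
  have "induced_linear V \<phi> (u 0 1) = (\<lambda>_. 0)"
  proof
    fix j
    have "induced_linear V \<phi> (u 0 1) j =
      (\<Sum>i\<in>V. unit_vec (\<phi> i) j * unit_vec a i) - (\<Sum>i\<in>V. unit_vec (\<phi> i) j * unit_vec b i)"
      unfolding induced_linear_def sum_subtractf[symmetric] by (simp add: u_def algebra_simps)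
    also have "\<dots> = 0" using V ab by (simp add: sum_unit_vec)
    finally show "induced_linear V \<phi> (u 0 1) j = 0" .
  qed
  then have "quad_form V g (u 0 1) = 0"
    using le[OF fv, of 0 1] nonneg[OF fv, of 0 1] by (simp add: quad_form_def)
  then have "g a a - 2 * g a b + g b b = 0" by (simp add: q)
  then have "0 \<le> t * (2 * (g a c - g b c)) + g c c" for t
    using nonneg[OF fv, of 1 t] by (simp add: q mult_ac)
  then show ?thesis using affine_nonneg_imp_slope_zero by fastforce
qed

lemma successively_const:
  assumes "xs \<noteq> []" "successively P xs"
    and "\<And>x y. x \<in> set xs \<Longrightarrow> y \<in> set xs \<Longrightarrow> P x y \<Longrightarrow> f x = f y"
  shows "f (hd xs) = f (last xs)"
  using assms
proof (induction xs)
  case (Cons x xs)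
  show ?case
  proof (cases "xs = []")
    case False
    then have P: "P x (hd xs)" "successively P xs"
      using Cons.prems(2) by (simp_all add: successively_Cons)
    have "f x = f (hd xs)"
      using Cons.prems(3)[of x "hd xs"] P(1) False by simp
    also have "f (hd xs) = f (last xs)"
      using False P(2) Cons.prems(3) by (intro Cons.IH) simp_all
    finally show ?thesis using False by simp
  qed simp
qed simp

lemma strongly_connected_vertex_path:
  assumes "strongly_connected V \<Delta> W \<Gamma> \<phi>" "a \<in> V" "b \<in> V" "\<phi> a \<in> W" "\<phi> b = \<phi> a"
  obtains xs where "xs \<noteq> []" "hd xs = a" "last xs = b" "\<forall>x\<in>set xs. \<phi> x = \<phi> a"
    "successively (\<lambda>x y. {x, y} \<in> \<Delta>) xs"
proof -
  have "\<forall>a\<in>V. \<forall>b\<in>V. \<forall>c\<in>W. \<phi> a = c \<and> \<phi> b = c \<longrightarrow>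
      (\<exists>xs. xs \<noteq> [] \<and> hd xs = a \<and> last xs = b \<and> set xs \<subseteq> V \<and> (\<forall>x\<in>set xs. \<phi> x = c) \<and>
            successively (\<lambda>x y. {x, y} \<in> \<Delta>) xs)"
    using assms(1) unfolding strongly_connected_def by (elim conjE)
  from bspec[OF bspec[OF bspec[OF this assms(2)] assms(3)] assms(4)] show thesis
    using assms(5) that by blast
qed

lemma strongly_connected_edge_path:
  assumes "strongly_connected V \<Delta> W \<Gamma> \<phi>" "a \<in> edges \<Delta>" "b \<in> edges \<Delta>" "\<phi> ` a \<in> edges \<Gamma>"
    "\<phi> ` b = \<phi> ` a"
  obtains es where "es \<noteq> []" "hd es = a" "last es = b" "\<forall>e\<in>set es. \<phi> ` e = \<phi> ` a"
    "successively (\<lambda>e f. e \<union> f \<in> \<Delta> \<and> e \<inter> f \<noteq> {}) es"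
proof -
  have "\<forall>a\<in>edges \<Delta>. \<forall>b\<in>edges \<Delta>. \<forall>c\<in>edges \<Gamma>. \<phi> ` a = c \<and> \<phi> ` b = c \<longrightarrow>
      (\<exists>es. es \<noteq> [] \<and> hd es = a \<and> last es = b \<and> set es \<subseteq> edges \<Delta> \<and> (\<forall>e\<in>set es. \<phi> ` e = c) \<and>
            successively (\<lambda>e f. e \<union> f \<in> \<Delta> \<and> e \<inter> f \<noteq> {}) es)"
    using assms(1) unfolding strongly_connected_def by (elim conjE)
  from bspec[OF bspec[OF bspec[OF this assms(2)] assms(3)] assms(4)] show thesis
    using assms(5) that by blast
qed

lemma dominated_coeff_well_defined:
  assumes S: "simplicial_complex V \<Delta>" and \<phi>: "strongly_connected V \<Delta> W \<Gamma> \<phi>"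
    and sym: "\<And>i j. g i j = g j i"
    and eq: "\<And>a b c. {a, b, c} \<in> \<Delta> \<Longrightarrow> \<phi> a = \<phi> b \<Longrightarrow> g a c = g b c"
    and ab: "{a, b} \<in> \<Delta>" "{a', b'} \<in> \<Delta>" "\<phi> a = \<phi> a'" "\<phi> b = \<phi> b'"
  shows "g a b = g a' b'"
proof -
  have V: "a \<in> V" "b \<in> V" "a' \<in> V" "b' \<in> V"
    using S ab unfolding simplicial_complex_def by auto
  have sub: "G \<in> \<Delta>" if "F \<in> \<Delta>" "G \<subseteq> F" for F G
    using S that unfolding simplicial_complex_def by blast
  have surj: "surjective_simplicial_map V \<Delta> W \<Gamma> \<phi>"
    using \<phi> unfolding strongly_connected_def by blast
  show ?thesis
  proof (cases "\<phi> a = \<phi> b")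
    case True
    have "\<phi> b \<in> W" using surjective_simplicial_mapD(1)[OF surj] V by blast
    then obtain xs where xs: "xs \<noteq> []" "hd xs = b" "last xs = b'" "\<forall>x\<in>set xs. \<phi> x = \<phi> b"
        "successively (\<lambda>x y. {x, y} \<in> \<Delta>) xs"
      using strongly_connected_vertex_path[OF \<phi> V(2,4) _ ab(4)[symmetric]] by blast
    have "g x x = g y y" if "x \<in> set xs" "y \<in> set xs" "{x, y} \<in> \<Delta>" for x y
    proof -
      have "\<phi> x = \<phi> y" using that xs(4) by simp
      then show ?thesis
        using eq[of x y x] eq[of x y y] that(3) sym[of x y] by (simp add: insert_commute)
    qed
    from successively_const[OF xs(1,5), of "\<lambda>x. g x x", OF this] xs(2,3)
    have "g b b = g b' b'" by simp
    moreover have "g a b = g b b" "g a' b' = g b' b'"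
      using eq[of a b b] eq[of a' b' b'] ab True by auto
    ultimately show ?thesis by simp
  next
    case False
    have "a \<noteq> b" "a' \<noteq> b'" using False ab(3,4) by auto
    then have edge: "{a, b} \<in> edges \<Delta>" "{a', b'} \<in> edges \<Delta>" "\<phi> ` {a, b} \<in> edges \<Gamma>"
      using False ab(1,2) surjective_simplicial_mapD(2)[OF surj ab(1)] by (simp_all add: edges_def)
    moreover have "\<phi> ` {a', b'} = \<phi> ` {a, b}" using ab(3,4) by simp
    ultimately
    obtain es where es: "es \<noteq> []" "hd es = {a, b}" "last es = {a', b'}"
        "\<forall>e\<in>set es. \<phi> ` e = \<phi> ` {a, b}" "successively (\<lambda>e f. e \<union> f \<in> \<Delta> \<and> e \<inter> f \<noteq> {}) es"
      by (rule strongly_connected_edge_path[OF \<phi>])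
    let ?s = "\<lambda>e. inv_into e \<phi> (\<phi> a)" and ?t = "\<lambda>e. inv_into e \<phi> (\<phi> b)"
    have inv: "?s e \<in> e" "?t e \<in> e" "\<phi> (?s e) = \<phi> a" "\<phi> (?t e) = \<phi> b" if "e \<in> set es" for e
    proof -
      have "\<phi> a \<in> \<phi> ` e" "\<phi> b \<in> \<phi> ` e" using that es(4) by auto
      then show "?s e \<in> e" "?t e \<in> e" "\<phi> (?s e) = \<phi> a" "\<phi> (?t e) = \<phi> b"
        by (auto intro: inv_into_into f_inv_into_f)
    qed
    have "g (?s e) (?t e) = g (?s f) (?t f)"
      if "e \<in> set es" "f \<in> set es" "e \<union> f \<in> \<Delta> \<and> e \<inter> f \<noteq> {}" for e f
    proof -
      have "{?s e, ?s f, ?t e} \<in> \<Delta>" "{?t e, ?t f, ?s f} \<in> \<Delta>"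
        using sub[of "e \<union> f"] that inv by auto
      then have "g (?s e) (?t e) = g (?s f) (?t e)" "g (?t e) (?s f) = g (?t f) (?s f)"
        using inv[OF that(1)] inv[OF that(2)] by (auto intro: eq)
      then show ?thesis using sym by metis
    qed
    from successively_const[OF es(1,5), of "\<lambda>e. g (?s e) (?t e)", OF this]
    have "g (?s {a, b}) (?t {a, b}) = g (?s {a', b'}) (?t {a', b'})"
      using es(2,3) by simp
    moreover have "inj_on \<phi> {a, b}" "inj_on \<phi> {a', b'}"
      using False ab(3,4) by (auto simp: inj_on_def)
    then have "?s {a, b} = a" "?t {a, b} = b" "?s {a', b'} = a'" "?t {a', b'} = b'"
      using ab(3,4) by (simp_all only: inv_into_f_eq insert_iff simp_thms)
    ultimately show ?thesis by simp
  qed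
qed

lemma dominated_by_pullback:
  assumes S: "simplicial_complex V \<Delta>" and T: "simplicial_complex W \<Gamma>"
    and \<phi>: "strongly_connected V \<Delta> W \<Gamma> \<phi>" and q: "q \<in> R2 W \<Gamma>" and y: "y \<in> nonneg_cone V \<Delta>"
    and le: "\<And>v. v \<in> face_vectors \<Delta> \<Longrightarrow> SR_eval y v \<le> SR_eval q (induced_linear V \<phi> v)"
  shows "\<exists>y'\<in>nonneg_cone W \<Gamma>.
    \<forall>v\<in>face_vectors \<Delta>. SR_eval y v = SR_eval y' (induced_linear V \<phi> v)"
proof -
  have surj: "surjective_simplicial_map V \<Delta> W \<Gamma> \<phi>"
    using \<phi> unfolding strongly_connected_def by blast
  note fv = induced_linear_face_vectors[OF S T surj]
  have W: "finite W" using T unfolding simplicial_complex_def by blast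
  have y2: "y \<in> R2 V \<Delta>" and y0: "\<And>v. v \<in> face_vectors \<Delta> \<Longrightarrow> 0 \<le> SR_eval y v"
    using y unfolding nonneg_cone_def by auto
  obtain g where g: "\<And>i j. g i j = g j i"
      "\<And>v. v \<in> face_vectors \<Delta> \<Longrightarrow> SR_eval y v = quad_form V g v"
    using R2_quad_form[OF S y2] by blast
  obtain k where k: "\<And>w. w \<in> face_vectors \<Gamma> \<Longrightarrow> SR_eval q w = quad_form W k w"
    using R2_quad_form[OF T q] by blast
  have nonneg: "0 \<le> quad_form V g v" if "v \<in> face_vectors \<Delta>" for v
    using y0[OF that] g(2)[OF that] by simp
  have bound: "quad_form V g v \<le> quad_form W k (induced_linear V \<phi> v)"
    if "v \<in> face_vectors \<Delta>" for v
    using le[OF that] g(2)[OF that] k[OF fv[OF that]] by simp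
  note eq = dominated_coeff_eq[OF S g(1) nonneg bound]
  define P where "P c d p \<longleftrightarrow> {fst p, snd p} \<in> \<Delta> \<and> \<phi> (fst p) = c \<and> \<phi> (snd p) = d" for c d p
  define h where "h c d = (let p = Eps (P c d) in g (fst p) (snd p))" for c d
  have h: "g a b = h (\<phi> a) (\<phi> b)" if "{a, b} \<in> \<Delta>" for a b
  proof -
    have "P (\<phi> a) (\<phi> b) (a, b)" using that by (simp add: P_def)
    then have "P (\<phi> a) (\<phi> b) (Eps (P (\<phi> a) (\<phi> b)))" by (rule someI)
    moreover obtain a' b' where p: "Eps (P (\<phi> a) (\<phi> b)) = (a', b')" by fastforce
    ultimately have "P (\<phi> a) (\<phi> b) (a', b')" by simp
    then have ab': "{a', b'} \<in> \<Delta>" "\<phi> a = \<phi> a'" "\<phi> b = \<phi> b'"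
      by (simp_all add: P_def)
    have "g a b = g a' b'"
      by (rule dominated_coeff_well_defined[OF S \<phi> g(1) eq that ab'])
    then show ?thesis by (simp add: h_def p)
  qed
  let ?y = "SR_class W \<Gamma> (quad_poly W h)"
  have ev: "SR_eval y v = SR_eval ?y (induced_linear V \<phi> v)" if v: "v \<in> face_vectors \<Delta>" for v
  proof -
    obtain F where F: "F \<in> \<Delta>" "\<forall>i. i \<notin> F \<longrightarrow> v i = 0"
      using v face_vectors_iff[OF S] by blast
    have "g i j * (v i * v j) = h (\<phi> i) (\<phi> j) * (v i * v j)" for i j
    proof (cases "i \<in> F \<and> j \<in> F")
      case True
      then have "{i, j} \<subseteq> F" by simp
      then have "{i, j} \<in> \<Delta>" using F(1) S unfolding simplicial_complex_def by metis
      then show ?thesis by (simp only: h)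
    next
      case False
      then have "v i * v j = 0" using F(2) by auto
      then show ?thesis by simp
    qed
    then have "quad_form V g v = quad_form V (\<lambda>i j. h (\<phi> i) (\<phi> j)) v"
      unfolding quad_form_def by (simp only:)
    then show ?thesis
      using quad_form_induced_linear[OF W surjective_simplicial_mapD(1)[OF surj], of h v]
      by (simp add: g(2)[OF v] SR_eval_class[OF T fv[OF v]])
  qed
  have "SR_eval ?y w \<ge> 0" if w: "w \<in> face_vectors \<Gamma>" for w
  proof -
    obtain v where v: "v \<in> face_vectors \<Delta>" "induced_linear V \<phi> v = w"
      by (rule face_vectors_lift[OF S T surj w])
    show ?thesis using y0[OF v(1)] unfolding ev[OF v(1)] v(2) .
  qed
  then have "?y \<in> nonneg_cone W \<Gamma>"
    unfolding nonneg_cone_def using SR_class_quad_poly_R2 by blast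
  then show ?thesis using ev by blast
qed

theorem corollary3p10:
  fixes V :: "'a set" and \<Delta> :: "'a set set"
    and W :: "'b set" and \<Gamma> :: "'b set set"
    and \<phi> :: "'a \<Rightarrow> 'b"
  assumes "simplicial_complex V \<Delta>"
    and "simplicial_complex W \<Gamma>"
    and "strongly_connected V \<Delta> W \<Gamma> \<phi>"
  shows "\<forall>q \<in> nonneg_cone W \<Gamma>.
           spans_extreme_ray (SR_algebra W \<Gamma>) (nonneg_cone W \<Gamma>) q \<longrightarrow>
           spans_extreme_ray (SR_algebra V \<Delta>) (nonneg_cone V \<Delta>) (pullback V \<Delta> \<phi> q)"
proof (intro ballI impI)
  note S = assms(1) and T = assms(2) and \<phi> = assms(3)
  have surj: "surjective_simplicial_map V \<Delta> W \<Gamma> \<phi>"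
    using \<phi> unfolding strongly_connected_def by blast
  note fv = induced_linear_face_vectors[OF S T surj]
  fix q assume q: "q \<in> nonneg_cone W \<Gamma>"
    and ext: "spans_extreme_ray (SR_algebra W \<Gamma>) (nonneg_cone W \<Gamma>) q"
  have q2: "q \<in> R2 W \<Gamma>" and q0: "\<And>w. w \<in> face_vectors \<Gamma> \<Longrightarrow> 0 \<le> SR_eval q w"
    using q unfolding nonneg_cone_def by auto
  let ?x = "pullback V \<Delta> \<phi> q"
  note x = pullback_R2[OF S T surj q2]
  have "?x \<in> nonneg_cone V \<Delta>"
    unfolding nonneg_cone_def using x q0 fv by simp
  moreover have "?x \<noteq> \<zero>\<^bsub>SR_algebra V \<Delta>\<^esub>"
  proof
    assume zero: "?x = \<zero>\<^bsub>SR_algebra V \<Delta>\<^esub>"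
    have "q = \<zero>\<^bsub>SR_algebra W \<Gamma>\<^esub>"
    proof (rule R2_eqI[OF T q2 R2_zero(1)[OF T]])
      fix w assume w: "w \<in> face_vectors \<Gamma>"
      then obtain v where v: "v \<in> face_vectors \<Delta>" "induced_linear V \<phi> v = w"
        using face_vectors_lift[OF S T surj] by blast
      then have "SR_eval q w = 0" using x(2)[OF v(1)] zero R2_zero(2)[OF S v(1)] by simp
      then show "SR_eval q w = SR_eval \<zero>\<^bsub>SR_algebra W \<Gamma>\<^esub> w"
        using R2_zero(2)[OF T w] by simp
    qed
    then show False using ext unfolding spans_extreme_ray_def by blast
  qed
  moreover have False
    if yz: "y \<in> nonneg_cone V \<Delta>" "z \<in> nonneg_cone V \<Delta>"
      and indep: "lin_indep_pair (SR_algebra V \<Delta>) y z"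
      and sum: "?x = y \<oplus>\<^bsub>SR_algebra V \<Delta>\<^esub> z" for y z
  proof -
    have y: "y \<in> R2 V \<Delta>" "\<And>v. v \<in> face_vectors \<Delta> \<Longrightarrow> 0 \<le> SR_eval y v"
      and z: "z \<in> R2 V \<Delta>" "\<And>v. v \<in> face_vectors \<Delta> \<Longrightarrow> 0 \<le> SR_eval z v"
      using yz unfolding nonneg_cone_def by auto
    have split: "SR_eval q (induced_linear V \<phi> v) = SR_eval y v + SR_eval z v"
      if "v \<in> face_vectors \<Delta>" for v
      using x(2)[OF that] R2_add(2)[OF S y(1) z(1) that] sum by simp
    have le: "SR_eval y v \<le> SR_eval q (induced_linear V \<phi> v)"
      "SR_eval z v \<le> SR_eval q (induced_linear V \<phi> v)" if "v \<in> face_vectors \<Delta>" for v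
      unfolding split[OF that] using y(2)[OF that] z(2)[OF that] by simp_all
    obtain y' where "y' \<in> nonneg_cone W \<Gamma>"
      "\<forall>v\<in>face_vectors \<Delta>. SR_eval y v = SR_eval y' (induced_linear V \<phi> v)"
      using dominated_by_pullback[OF S T \<phi> q2 yz(1) le(1)] by blast
    note y' = this[rule_format]
    obtain z' where "z' \<in> nonneg_cone W \<Gamma>"
      "\<forall>v\<in>face_vectors \<Delta>. SR_eval z v = SR_eval z' (induced_linear V \<phi> v)"
      using dominated_by_pullback[OF S T \<phi> q2 yz(2) le(2)] by blast
    note z' = this[rule_format]
    have R2': "y' \<in> R2 W \<Gamma>" "z' \<in> R2 W \<Gamma>"
      using y'(1) z'(1) unfolding nonneg_cone_def by auto
    have "q = y' \<oplus>\<^bsub>SR_algebra W \<Gamma>\<^esub> z'"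
    proof (rule R2_eqI[OF T q2 R2_add(1)[OF T R2']])
      fix w assume w: "w \<in> face_vectors \<Gamma>"
      then obtain v where v: "v \<in> face_vectors \<Delta>" "induced_linear V \<phi> v = w"
        using face_vectors_lift[OF S T surj] by blast
      then show "SR_eval q w = SR_eval (y' \<oplus>\<^bsub>SR_algebra W \<Gamma>\<^esub> z') w"
        using split[OF v(1)] y'(2)[OF v(1)] z'(2)[OF v(1)] R2_add(2)[OF T R2' w] by simp
    qed
    moreover have "lin_indep_pair (SR_algebra W \<Gamma>) y' z'"
      unfolding lin_indep_pair_R2_iff[OF T R2']
    proof (intro allI impI)
      fix a b assume zero: "\<forall>w\<in>face_vectors \<Gamma>. a * SR_eval y' w + b * SR_eval z' w = 0"
      have "\<forall>v\<in>face_vectors \<Delta>. a * SR_eval y v + b * SR_eval z v = 0"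
      proof
        fix v assume v: "v \<in> face_vectors \<Delta>"
        show "a * SR_eval y v + b * SR_eval z v = 0"
          unfolding y'(2)[OF v] z'(2)[OF v] by (rule bspec[OF zero fv[OF v]])
      qed
      then show "a = 0 \<and> b = 0"
        using indep unfolding lin_indep_pair_R2_iff[OF S y(1) z(1)] by blast
    qed
    ultimately show False
      using ext y'(1) z'(1) unfolding spans_extreme_ray_def by metis
  qed
  ultimately show "spans_extreme_ray (SR_algebra V \<Delta>) (nonneg_cone V \<Delta>) ?x"
    unfolding spans_extreme_ray_def by blast
qed

end
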